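(* Let $A$ be an ordered blueprint. The ideals of $A$ with respect to the algebraic coverage (the algebraic ideals) are exactly the $k$-ideals of $A$, and the spectrum $\operatorname{Spec}A$ of $A$ as a covered monoid with the algebraic coverage coincides with the prime spectrum of $A$ as an ordered blueprint (where the prime spectrum, a topological space, is identified with its frame of open sets).
   Context: An ordered blueprint $(A,\cdot,\leqslant)$ is a multiplicative commutative monoid $A$ with absorbing element $0$, together with a preorder $\leqslant$ on the semiring $\mathbb N[A]^+$ of formal finite sums of elements of $A$, compatible with the addition and multiplication of $\mathbb N[A]^+$, such that $0\leqslant\sum_\emptyset$ and $\sum_\emptyset\leqslant0$ (with $\sum_\emptyset$ the empty sum), and such that $a\leqslant b$ and $b\leqslant a$ imply $a=b$ for $a,b\in A$. Write $x\equiv y$ if $x\leqslant y$ and $y\leqslant x$. The algebraic coverage is the closure operator $[S]=\{a\mid \text{there are finite families } s_i,s'_j\in S \text{ with } a+\sum_is_i\equiv\sum_js'_j\}$ on $\mathcal P(A)$; it satisfies $[S]\cdot[T]\subset[S\cdot T]$. A flat is a set $C$ with $[C]=C$. An (algebraic) ideal is a flat $I$ with $A\cdot I\subset I$; a prime ideal is an ideal $I\neq A$ with $xy\in I\Rightarrow x\in I$ or $y\in I$. A $k$-ideal is a subset $I\subset A$ with $0\in I$, $I\cdot A=I$, and such that $c+\sum_ia_i\equiv\sum_jb_j$ with $a_i,b_j\in I$ (finite sums) implies $c\in I$. The prime spectrum of $A$ as an ordered blueprint is the set of $k$-ideals $I\ne A$ with $xy\in I\Rightarrow x\in I$ or $y\in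 I$, with the topology generated by the sets $D(a)=\{I\mid a\notin I\}$, $a\in A$. A suplattice is a poset with all suprema; a quantale is a suplattice with an associative multiplication distributing over arbitrary joins in each variable. The set $\mathcal C(A)$ of flats is a quantale with joins $[\bigcup_\alpha C_\alpha]$ and product $[C\cdot D]$. A frame is a suplattice in which binary meet distributes over arbitrary joins, regarded as a quantale with multiplication $\wedge$. A strong morphism of quantales is a map preserving arbitrary joins and products. For a quantale $\mathcal Q$, $\operatorname{Spec}\mathcal Q$ is the frame equipped with a strong morphism $\mathcal Q\to\operatorname{Spec}\mathcal Q$ initial among strong morphisms from $\mathcal Q$ to frames (this exists, by a theorem of Rosenthal), and $\operatorname{Spec}A=\operatorname{Spec}\mathcal C(A)$. *)

theory Defs
  imports
    "HOL-Library.Multiset"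
    "HOL-Library.Set_Algebras"
    "HOL-Algebra.Complete_Lattice"
    "HOL-Analysis.Abstract_Topology"
begin

section \<open>Ordered blueprints\<close>

text \<open>The semiring of formal finite sums of elements of the monoid \<open>'a\<close> is the type of finite
  multisets over \<open>'a\<close>. The element \<open>0\<close> of \<open>'a\<close> is not identified with the empty sum: the formal
  sum \<open>{#0#}\<close> has one term. Addition is addition of multisets; multiplication is the following.\<close>

definition formal_mult :: "'a::times multiset \<Rightarrow> 'a multiset \<Rightarrow> 'a multiset" where
  "formal_mult M N = (\<Sum>a\<in>#M. {#a * b. b \<in># N#})"

text \<open>The sort \<open>{comm_monoid_mult, mult_zero}\<close> says that \<open>'a\<close> is a commutative monoid with an
  absorbing element \<open>0\<close>; the case \<open>0 = 1\<close> is allowed.\<close>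

locale ordered_blueprint =
  fixes leq :: "'a::{comm_monoid_mult, mult_zero} multiset \<Rightarrow> 'a multiset \<Rightarrow> bool"
    (infix \<open>\<preceq>\<close> 50)
  assumes refl: "x \<preceq> x"
    and trans: "x \<preceq> y \<Longrightarrow> y \<preceq> z \<Longrightarrow> x \<preceq> z"
    and add_compat: "x \<preceq> y \<Longrightarrow> z \<preceq> w \<Longrightarrow> x + z \<preceq> y + w"
    and mult_compat: "x \<preceq> y \<Longrightarrow> z \<preceq> w \<Longrightarrow> formal_mult x z \<preceq> formal_mult y w"
    and zero_le_empty: "{#0#} \<preceq> {#}"
    and empty_le_zero: "{#} \<preceq> {#0#}"
    and antisym_elem: "{#a#} \<preceq> {#b#} \<Longrightarrow> {#b#} \<preceq> {#a#} \<Longrightarrow> a = b"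

definition formal_equiv :: "('a multiset \<Rightarrow> 'a multiset \<Rightarrow> bool) \<Rightarrow> 'a multiset \<Rightarrow> 'a multiset \<Rightarrow> bool"
  where "formal_equiv leq x y \<longleftrightarrow> leq x y \<and> leq y x"

section \<open>Algebraic coverage, flats and ideals\<close>

definition alg_coverage :: "('a multiset \<Rightarrow> 'a multiset \<Rightarrow> bool) \<Rightarrow> 'a set \<Rightarrow> 'a set" where
  "alg_coverage leq S =
     {a. \<exists>M N. set_mset M \<subseteq> S \<and> set_mset N \<subseteq> S \<and> formal_equiv leq ({#a#} + M) N}"

definition is_flat :: "('a multiset \<Rightarrow> 'a multiset \<Rightarrow> bool) \<Rightarrow> 'a set \<Rightarrow> bool" where
  "is_flat leq C \<longleftrightarrow> alg_coverage leq C = C"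

definition algebraic_ideal :: "('a::times multiset \<Rightarrow> 'a multiset \<Rightarrow> bool) \<Rightarrow> 'a set \<Rightarrow> bool" where
  "algebraic_ideal leq I \<longleftrightarrow> is_flat leq I \<and> UNIV * I \<subseteq> I"

definition k_ideal :: "('a::mult_zero multiset \<Rightarrow> 'a multiset \<Rightarrow> bool) \<Rightarrow> 'a set \<Rightarrow> bool" where
  "k_ideal leq I \<longleftrightarrow> 0 \<in> I \<and> I * UNIV = I \<and>
     (\<forall>c M N. set_mset M \<subseteq> I \<longrightarrow> set_mset N \<subseteq> I \<longrightarrow> formal_equiv leq ({#c#} + M) N \<longrightarrow> c \<in> I)"

section \<open>The prime spectrum of an ordered blueprint\<close>

definition prime_spectrum :: "('a::mult_zero multiset \<Rightarrow> 'a multiset \<Rightarrow> bool) \<Rightarrow> 'a set set" where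
  "prime_spectrum leq =
     {I. k_ideal leq I \<and> I \<noteq> UNIV \<and> (\<forall>x y. x * y \<in> I \<longrightarrow> x \<in> I \<or> y \<in> I)}"

definition basic_open :: "('a::mult_zero multiset \<Rightarrow> 'a multiset \<Rightarrow> bool) \<Rightarrow> 'a \<Rightarrow> 'a set set" where
  "basic_open leq a = {I \<in> prime_spectrum leq. a \<notin> I}"

definition prime_spectrum_topology ::
    "('a::mult_zero multiset \<Rightarrow> 'a multiset \<Rightarrow> bool) \<Rightarrow> 'a set topology" where
  "prime_spectrum_topology leq = topology_generated_by (range (basic_open leq))"

text \<open>The library takes the union of the generating sets as underlying space; here that is the
  whole prime spectrum.\<close>

lemma topspace_prime_spectrum_topology:
  fixes leq :: "'a::{comm_monoid_mult, mult_zero} multiset \<Rightarrow> 'a multiset \<Rightarrow> bool"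
  shows "topspace (prime_spectrum_topology leq) = prime_spectrum leq"
proof -
  have "1 \<notin> I" if "I \<in> prime_spectrum leq" for I
  proof
    assume "1 \<in> I"
    from that have "I * UNIV = I" "I \<noteq> UNIV"
      by (simp_all add: prime_spectrum_def k_ideal_def)
    moreover have "x \<in> I * UNIV" for x
      using set_times_intro[OF \<open>1 \<in> I\<close> UNIV_I[of x]] by simp
    ultimately show False by auto
  qed
  then show ?thesis
    by (auto simp: prime_spectrum_topology_def topology_generated_by_topspace basic_open_def)
qed

section \<open>Quantales, frames and their spectra\<close>

locale suplattice = partial_order +
  assumes sup_exists: "A \<subseteq> carrier L \<Longrightarrow> \<exists>s. least L s (Upper L A)"

sublocale suplattice \<subseteq> complete_lattice
proof (rule complete_latticeI)
  fix A assume A: "A \<subseteq> carrier L"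
  obtain i where i: "least L i (Upper L (Lower L A))"
    using sup_exists[of "Lower L A"] by auto
  have "greatest L i (Lower L A)"
    using A i unfolding least_def greatest_def Upper_def Lower_def by blast
  then show "\<exists>i. greatest L i (Lower L A)" ..
qed (rule sup_exists)

record 'a mult_order = "'a gorder" +
  qmult :: "'a \<Rightarrow> 'a \<Rightarrow> 'a"  (infixl \<open>\<cdot>\<index>\<close> 70)

locale quantale = suplattice Q for Q (structure) +
  assumes qmult_closed: "x \<in> carrier Q \<Longrightarrow> y \<in> carrier Q \<Longrightarrow> x \<cdot> y \<in> carrier Q"
    and qmult_assoc: "x \<in> carrier Q \<Longrightarrow> y \<in> carrier Q \<Longrightarrow> z \<in> carrier Q \<Longrightarrow>
      (x \<cdot> y) \<cdot> z = x \<cdot> (y \<cdot> z)"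
    and qmult_Sup: "x \<in> carrier Q \<Longrightarrow> S \<subseteq> carrier Q \<Longrightarrow> x \<cdot> (\<Squnion>S) = \<Squnion>((\<lambda>y. x \<cdot> y) ` S)"
    and Sup_qmult: "x \<in> carrier Q \<Longrightarrow> S \<subseteq> carrier Q \<Longrightarrow> (\<Squnion>S) \<cdot> x = \<Squnion>((\<lambda>y. y \<cdot> x) ` S)"

text \<open>A frame, regarded as a quantale with the binary meet as multiplication.\<close>

locale frame = suplattice F for F (structure) +
  assumes meet_Sup: "x \<in> carrier F \<Longrightarrow> S \<subseteq> carrier F \<Longrightarrow> x \<sqinter> (\<Squnion>S) = \<Squnion>((\<lambda>y. x \<sqinter> y) ` S)"
    and qmult_meet: "x \<in> carrier F \<Longrightarrow> y \<in> carrier F \<Longrightarrow> x \<cdot> y = x \<sqinter> y"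

text \<open>Quantales are not required to have a unit, so strong morphisms preserve binary products
  only; joins include the empty one.\<close>

definition strong_morphism :: "'q mult_order \<Rightarrow> 'r mult_order \<Rightarrow> ('q \<Rightarrow> 'r) \<Rightarrow> bool" where
  "strong_morphism Q R f \<longleftrightarrow>
     f \<in> carrier Q \<rightarrow> carrier R \<and>
     (\<forall>S. S \<subseteq> carrier Q \<longrightarrow> f (\<Squnion>\<^bsub>Q\<^esub>S) = \<Squnion>\<^bsub>R\<^esub>(f ` S)) \<and>
     (\<forall>x\<in>carrier Q. \<forall>y\<in>carrier Q. f (x \<cdot>\<^bsub>Q\<^esub> y) = f x \<cdot>\<^bsub>R\<^esub> f y)"

text \<open>\<open>is_Spec TYPE('f) Q S \<eta>\<close>: the frame \<open>S\<close> with the strong morphism \<open>\<eta>\<close> from \<open>Q\<close> is initial among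
  strong morphisms from the quantale \<open>Q\<close> to frames whose elements have type \<open>'f\<close>. A formula cannot
  quantify over types; initiality among all frames is obtained by stating \<open>is_Spec\<close> for an
  arbitrary type \<open>'f\<close>. Membership in \<open>extensional\<close> makes \<open>g\<close> unique outside the carrier.\<close>

definition is_Spec ::
    "'f itself \<Rightarrow> 'q mult_order \<Rightarrow> 's mult_order \<Rightarrow> ('q \<Rightarrow> 's) \<Rightarrow> bool" where
  "is_Spec T Q S \<eta> \<longleftrightarrow>
     quantale Q \<and> frame S \<and> strong_morphism Q S \<eta> \<and>
     (\<forall>(F :: 'f mult_order) \<phi>. frame F \<longrightarrow> strong_morphism Q F \<phi> \<longrightarrow>
        (\<exists>!g. g \<in> extensional (carrier S) \<and> strong_morphism S F g \<and>
              (\<forall>x\<in>carrier Q. g (\<eta> x) = \<phi> x)))"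

text \<open>The quantale of flats. Joins are determined by the inclusion order.\<close>

definition flat_quantale :: "('a::times multiset \<Rightarrow> 'a multiset \<Rightarrow> bool) \<Rightarrow> 'a set mult_order" where
  "flat_quantale leq =
     \<lparr>carrier = {C. is_flat leq C}, eq = (=), le = (\<subseteq>), qmult = (\<lambda>C D. alg_coverage leq (C * D))\<rparr>"

definition open_frame :: "'p topology \<Rightarrow> 'p set mult_order" where
  "open_frame X = \<lparr>carrier = {U. openin X U}, eq = (=), le = (\<subseteq>), qmult = (\<inter>)\<rparr>"

end

(* The algebraic coverage is a finitary closure operator with [S] * [T] contained in [S * T], so an
   ideal disjoint from a multiplicative set extends, by Zorn's lemma, to a prime ideal disjoint from
   that set. The map C |-> {P. C not contained in P} is then a strong morphism from flats onto the
   open sets of the prime spectrum. Every strong morphism phi to a frame factors uniquely through it: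
   if every prime that contains D contains C, then separation by primes gives phi C <= phi D. *)

theory Submission
  imports Defs
begin

section \<open>Inclusion orders and strong morphisms\<close>

lemma inclusion_partial_order:
  fixes L :: "('a set, 'b) gorder_scheme"
  assumes "eq L = (=)" "le L = (\<subseteq>)"
  shows "partial_order L"
  by unfold_locales (auto simp: assms)

text \<open>Serves both flats and open sets: each is ordered by inclusion, and only the candidate
  \<open>s\<close> differs, a closed-up union in one case and a plain union in the other.\<close>

lemma least_Upper_inclusionI:
  fixes L :: "('a set, 'b) gorder_scheme"
  assumes "le L = (\<subseteq>)" "s \<in> carrier L" "A \<subseteq> carrier L" "\<Union>A \<subseteq> s"
    and "\<And>t. t \<in> carrier L \<Longrightarrow> \<Union>A \<subseteq> t \<Longrightarrow> s \<subseteq> t"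
  shows "least L s (Upper L A)"
  unfolding least_def Upper_def assms(1)
proof (intro conjI ballI)
  show "s \<in> {u. \<forall>x. x \<in> A \<inter> carrier L \<longrightarrow> x \<subseteq> u} \<inter> carrier L"
    using assms(2,4) by blast
  show "s \<subseteq> t" if "t \<in> {u. \<forall>x. x \<in> A \<inter> carrier L \<longrightarrow> x \<subseteq> u} \<inter> carrier L" for t
    using that assms(3) by (intro assms(5)) blast+
qed blast

text \<open>Joins are defined by a choice operator, so a value can be computed only through the
  uniqueness of least upper bounds.\<close>

lemma (in partial_order) sup_eqI: "least L s (Upper L A) \<Longrightarrow> \<Squnion>A = s"
  unfolding sup_def by (rule some_equality) (auto intro: least_unique)

lemma (in partial_order) inf_eqI: "greatest L s (Lower L A) \<Longrightarrow> \<Sqinter>A = s"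
  unfolding inf_def by (rule some_equality) (auto intro: greatest_unique)

lemma (in partial_order) sup_doubleton:
  assumes "x \<sqsubseteq> y" "x \<in> carrier L" "y \<in> carrier L"
  shows "\<Squnion>{x, y} = y"
  by (rule sup_eqI) (use assms in \<open>auto simp: least_def Upper_def\<close>)

text \<open>The order is encoded in joins: \<open>x\<close> lies below \<open>y\<close> exactly when
  the join of \<open>{x, y}\<close> is \<open>y\<close>, and this equation is preserved.\<close>

lemma strong_morphism_mono:
  assumes "quantale Q" "suplattice R" "strong_morphism Q R f"
    and "x \<sqsubseteq>\<^bsub>Q\<^esub> y" "x \<in> carrier Q" "y \<in> carrier Q"
  shows "f x \<sqsubseteq>\<^bsub>R\<^esub> f y"
proof -
  interpret Q: quantale Q by fact
  interpret R: suplattice R by fact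
  have carr: "f x \<in> carrier R" "f y \<in> carrier R"
    using assms by (auto simp: strong_morphism_def)
  have "f y = f (\<Squnion>\<^bsub>Q\<^esub>{x, y})"
    using assms by (simp add: Q.sup_doubleton)
  also have "\<dots> = \<Squnion>\<^bsub>R\<^esub>{f x, f y}"
    using assms by (simp add: strong_morphism_def)
  finally show ?thesis
    using R.sup_upper[of "{f x, f y}" "f x"] carr by simp
qed

text \<open>Surjectivity of \<open>\<eta>\<close> forces the values of \<open>g\<close>, and
  \<open>ker\<close> makes them well defined. Joins and products in \<open>S\<close> are images of
  joins and products in \<open>Q\<close>, so \<open>g\<close> inherits their preservation from
  \<open>\<phi>\<close>.\<close>

lemma strong_morphism_factor:
  assumes Q: "quantale Q"
    and \<eta>: "strong_morphism Q S \<eta>" and surj: "\<eta> ` carrier Q = carrier S"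
    and \<phi>: "strong_morphism Q F \<phi>"
    and ker: "\<And>x y. x \<in> carrier Q \<Longrightarrow> y \<in> carrier Q \<Longrightarrow> \<eta> x = \<eta> y \<Longrightarrow> \<phi> x = \<phi> y"
  shows "\<exists>!g. g \<in> extensional (carrier S) \<and> strong_morphism S F g \<and>
    (\<forall>x\<in>carrier Q. g (\<eta> x) = \<phi> x)"
proof -
  interpret Q: quantale Q by fact
  \<comment> \<open>\<open>inv_into\<close> picks an arbitrary preimage; by \<open>ker\<close> the
    value of \<open>\<phi>\<close> does not depend on the choice.\<close>
  define g where "g = restrict (\<lambda>u. \<phi> (inv_into (carrier Q) \<eta> u)) (carrier S)"
  have g: "g (\<eta> x) = \<phi> x" if "x \<in> carrier Q" for x
  proof -
    have "\<eta> x \<in> \<eta> ` carrier Q" using that by simp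
    then have "\<phi> (inv_into (carrier Q) \<eta> (\<eta> x)) = \<phi> x"
      using that by (intro ker) (auto simp: inv_into_into f_inv_into_f)
    then show ?thesis
      using that surj by (auto simp: g_def)
  qed
  have "g \<in> carrier S \<rightarrow> carrier F"
  proof
    fix u assume "u \<in> carrier S"
    then obtain x where "x \<in> carrier Q" "u = \<eta> x"
      using surj by blast
    then show "g u \<in> carrier F"
      using g \<phi> by (auto simp only: strong_morphism_def Pi_iff)
  qed
  moreover have "g (\<Squnion>\<^bsub>S\<^esub>U) = \<Squnion>\<^bsub>F\<^esub>(g ` U)" if "U \<subseteq> carrier S" for U
  proof -
    have "U \<subseteq> \<eta> ` carrier Q"
      using that surj by simp
    then obtain X where X: "X \<subseteq> carrier Q" "U = \<eta> ` X"
      by (rule subset_imageE)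
    have "\<Squnion>\<^bsub>S\<^esub>U = \<eta> (\<Squnion>\<^bsub>Q\<^esub>X)"
      using \<eta> X by (simp add: strong_morphism_def)
    then have "g (\<Squnion>\<^bsub>S\<^esub>U) = \<phi> (\<Squnion>\<^bsub>Q\<^esub>X)"
      using X g by simp
    also have "\<dots> = \<Squnion>\<^bsub>F\<^esub>(\<phi> ` X)"
      using \<phi> X by (simp add: strong_morphism_def)
    also have "\<phi> ` X = g ` U"
      unfolding X(2) image_image by (rule image_cong) (use X g in auto)
    finally show ?thesis .
  qed
  moreover have "g (u \<cdot>\<^bsub>S\<^esub> v) = g u \<cdot>\<^bsub>F\<^esub> g v" if uv: "u \<in> carrier S" "v \<in> carrier S" for u v
  proof -
    obtain x y where xy: "x \<in> carrier Q" "y \<in> carrier Q" "u = \<eta> x" "v = \<eta> y"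
      using uv surj by blast
    then have "u \<cdot>\<^bsub>S\<^esub> v = \<eta> (x \<cdot>\<^bsub>Q\<^esub> y)"
      using \<eta> by (simp add: strong_morphism_def)
    then show ?thesis
      using xy g \<phi> Q.qmult_closed by (simp add: strong_morphism_def)
  qed
  ultimately have "strong_morphism S F g"
    by (simp add: strong_morphism_def)
  moreover have "g \<in> extensional (carrier S)"
    by (simp add: g_def)
  moreover have "h = g" if "h \<in> extensional (carrier S)" "\<forall>x\<in>carrier Q. h (\<eta> x) = \<phi> x" for h
  proof (rule extensionalityI)
    fix u assume "u \<in> carrier S"
    then obtain x where "x \<in> carrier Q" "u = \<eta> x"
      using surj by blast
    then show "h u = g u"
      using that(2) g by simp
  qed (fact that(1), fact \<open>g \<in> extensional _\<close>)
  ultimately show ?thesis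
    using g by blast
qed

section \<open>The frame of open sets\<close>

lemma open_frame_simps [simp]:
  "carrier (open_frame X) = {U. openin X U}" "eq (open_frame X) = (=)"
  "le (open_frame X) = (\<subseteq>)" "qmult (open_frame X) = (\<inter>)"
  by (simp_all add: open_frame_def)

lemma partial_order_open_frame: "partial_order (open_frame X)"
  by (rule inclusion_partial_order) simp_all

lemma Sup_open_frame:
  assumes "\<U> \<subseteq> {U. openin X U}"
  shows "\<Squnion>\<^bsub>open_frame X\<^esub>\<U> = \<Union>\<U>"
  by (intro partial_order.sup_eqI partial_order_open_frame least_Upper_inclusionI)
    (use assms in auto)

text \<open>Unions and binary intersections of open sets are open, so they are the joins and meets,
  and distributivity is that of sets.\<close>

lemma frame_open_frame: "frame (open_frame X)"
proof -
  interpret partial_order "open_frame X" by (rule partial_order_open_frame)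
  have inter: "U \<sqinter>\<^bsub>open_frame X\<^esub> V = U \<inter> V" if "openin X U" "openin X V" for U V
    unfolding meet_def
    by (rule inf_eqI) (use that in \<open>auto simp: greatest_def Lower_def\<close>)
  show ?thesis
  proof unfold_locales
    fix \<U> assume "\<U> \<subseteq> carrier (open_frame X)"
    then have "least (open_frame X) (\<Union>\<U>) (Upper (open_frame X) \<U>)"
      by (intro least_Upper_inclusionI) auto
    then show "\<exists>s. least (open_frame X) s (Upper (open_frame X) \<U>)" ..
  next
    fix U \<U> assume *: "U \<in> carrier (open_frame X)" "\<U> \<subseteq> carrier (open_frame X)"
    then have "(\<lambda>V. U \<sqinter>\<^bsub>open_frame X\<^esub> V) ` \<U> = (\<inter>) U ` \<U>"
      using inter by (intro image_cong) auto
    moreover have "openin X (\<Union>\<U>)" "(\<inter>) U ` \<U> \<subseteq> {U. openin X U}"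
      using * by auto
    ultimately show "U \<sqinter>\<^bsub>open_frame X\<^esub> (\<Squnion>\<^bsub>open_frame X\<^esub>\<U>) =
        \<Squnion>\<^bsub>open_frame X\<^esub>((\<lambda>V. U \<sqinter>\<^bsub>open_frame X\<^esub> V) ` \<U>)"
      using * inter by (simp add: Sup_open_frame)
  qed (simp add: inter)
qed

section \<open>The algebraic coverage\<close>

context ordered_blueprint
begin

abbreviation equiv :: "'a multiset \<Rightarrow> 'a multiset \<Rightarrow> bool" (infix \<open>\<approx>\<close> 50) where
  "x \<approx> y \<equiv> formal_equiv (\<preceq>) x y"

abbreviation cover :: "'a set \<Rightarrow> 'a set" where
  "cover \<equiv> alg_coverage (\<preceq>)"

lemma equiv_refl: "x \<approx> x"
  by (simp add: formal_equiv_def refl)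

lemma equiv_trans: "x \<approx> y \<Longrightarrow> y \<approx> z \<Longrightarrow> x \<approx> z"
  unfolding formal_equiv_def using trans by blast

lemma equiv_sym: "x \<approx> y \<Longrightarrow> y \<approx> x"
  by (auto simp: formal_equiv_def)

lemma equiv_add: "x \<approx> y \<Longrightarrow> z \<approx> w \<Longrightarrow> x + z \<approx> y + w"
  by (simp add: formal_equiv_def add_compat)

text \<open>This is compatibility with multiplication by the one-term sum
  \<open>{#t#}\<close>.\<close>

lemma equiv_scale: "x \<approx> y \<Longrightarrow> image_mset ((*) t) x \<approx> image_mset ((*) t) y"
  using mult_compat[OF refl[of "{#t#}"]] by (simp add: formal_equiv_def formal_mult_def)

lemma cover_mono: "S \<subseteq> T \<Longrightarrow> cover S \<subseteq> cover T"
  unfolding alg_coverage_def by blast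

lemma coverI:
  "set_mset M \<subseteq> S \<Longrightarrow> set_mset N \<subseteq> S \<Longrightarrow> {#a#} + M \<approx> N \<Longrightarrow> a \<in> cover S"
  unfolding alg_coverage_def by blast

lemma subset_cover: "S \<subseteq> cover S"
  using coverI[of "{#}" S "{#a#}" a for a] by (auto simp: equiv_refl)

text \<open>Both witnessing families are empty, because \<open>0\<close> is equivalent to the empty
  sum; hence even the cover of the empty set contains \<open>0\<close>.\<close>

lemma zero_in_cover: "0 \<in> cover S"
  by (rule coverI[of "{#}" _ "{#}"])
    (simp_all add: formal_equiv_def zero_le_empty empty_le_zero)

text \<open>Adding the relations that witness the single terms gives one relation for the whole sum.
  This is the tool for idempotence of \<open>cover\<close>.\<close>

lemma cover_formal_sum:
  assumes "set_mset M \<subseteq> cover S"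
  shows "\<exists>P N. set_mset P \<subseteq> S \<and> set_mset N \<subseteq> S \<and> M + P \<approx> N"
  using assms
proof (induction M)
  case empty
  show ?case using equiv_refl by (auto intro!: exI[of _ "{#}"])
next
  case (add a M)
  then obtain P N where PN: "set_mset P \<subseteq> S" "set_mset N \<subseteq> S" "M + P \<approx> N" by auto
  from add.prems obtain P' N' where
    PN': "set_mset P' \<subseteq> S" "set_mset N' \<subseteq> S" "{#a#} + P' \<approx> N'"
    unfolding alg_coverage_def by auto
  have "add_mset a M + (P' + P) \<approx> N' + N"
    using equiv_add[OF PN'(3) PN(3)] by (simp add: ac_simps)
  then show ?case using PN PN' by (intro exI[of _ "P' + P"] exI[of _ "N' + N"]) auto
qed

lemma cover_cover [simp]: "cover (cover S) = cover S"
proof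
  show "cover (cover S) \<subseteq> cover S"
  proof
    fix a assume "a \<in> cover (cover S)"
    then obtain M N where MN: "set_mset M \<subseteq> cover S" "set_mset N \<subseteq> cover S" "{#a#} + M \<approx> N"
      unfolding alg_coverage_def[of _ "cover S"] by auto
    obtain P P' where P: "set_mset P \<subseteq> S" "set_mset P' \<subseteq> S" "M + P \<approx> P'"
      using cover_formal_sum[OF MN(1)] by auto
    obtain R R' where R: "set_mset R \<subseteq> S" "set_mset R' \<subseteq> S" "N + R \<approx> R'"
      using cover_formal_sum[OF MN(2)] by auto
    \<comment> \<open>Sums cannot be cancelled, so \<open>P\<close> and \<open>R\<close> are added
      to both sides of \<open>{#a#} + M \<approx> N\<close>. Then \<open>M + P\<close> becomes
      \<open>P'\<close> and \<open>N + R\<close> becomes \<open>R'\<close>, and every term other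
      than \<open>a\<close> lies in \<open>S\<close>.\<close>
    have "{#a#} + (P' + R) \<approx> {#a#} + (M + P) + R"
      using equiv_add[OF equiv_add[OF equiv_refl[of "{#a#}"] equiv_sym[OF P(3)]] equiv_refl[of R]]
      by (simp add: ac_simps)
    moreover have "{#a#} + (M + P) + R \<approx> N + (P + R)"
      using equiv_add[OF MN(3) equiv_refl[of "P + R"]] by (simp add: ac_simps)
    moreover have "N + (P + R) \<approx> R' + P"
      using equiv_add[OF R(3) equiv_refl[of P]] by (simp add: ac_simps)
    ultimately have "{#a#} + (P' + R) \<approx> R' + P"
      using equiv_trans by blast
    then show "a \<in> cover S"
      by (rule coverI[rotated 2]) (use P R in auto)
  qed
qed (rule subset_cover)

lemma cover_subset_iff: "cover S \<subseteq> cover T \<longleftrightarrow> S \<subseteq> cover T"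
  using cover_mono[of S "cover T"] subset_cover[of S] by auto

lemma scale_cover:
  assumes "a \<in> cover S"
  shows "t * a \<in> cover ({t} * S)"
proof -
  obtain M N where MN: "set_mset M \<subseteq> S" "set_mset N \<subseteq> S" "{#a#} + M \<approx> N"
    using assms unfolding alg_coverage_def by auto
  have "{#t * a#} + image_mset ((*) t) M \<approx> image_mset ((*) t) N"
    using equiv_scale[OF MN(3), of t] by simp
  then show ?thesis
    by (rule coverI[rotated 2]) (use MN in \<open>auto intro!: set_times_intro\<close>)
qed

text \<open>One factor at a time: multiplying two relations of the form \<open>a + M \<approx> N\<close> directly would leave
  mixed terms such as \<open>a\<close> times an element of \<open>T\<close>, which need not lie in \<open>S * T\<close>.\<close>

lemma cover_times_subset: "cover S * cover T \<subseteq> cover (S * T)"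
proof -
  have one: "X * cover Y \<subseteq> cover (X * Y)" for X Y
  proof
    fix z assume "z \<in> X * cover Y"
    then obtain x y where "x \<in> X" "y \<in> cover Y" "z = x * y"
      by (rule set_times_elim)
    then show "z \<in> cover (X * Y)"
      using scale_cover[of y Y x] cover_mono[OF set_times_mono2[of "{x}" X Y Y]] by auto
  qed
  have "cover S * cover T \<subseteq> cover (T * cover S)"
    using one[of "cover S" T] by (simp add: mult.commute)
  also have "\<dots> \<subseteq> cover (S * T)"
    using one[of T S] by (simp add: cover_subset_iff mult.commute)
  finally show ?thesis .
qed

text \<open>Lets products of flats be computed on generating sets.\<close>

lemma cover_times_cover: "cover (cover S * cover T) = cover (S * T)"
  using cover_times_subset[of S T] cover_mono[OF set_times_mono2[OF subset_cover subset_cover], of S T]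
  by (intro subset_antisym) (simp_all add: cover_subset_iff)

lemma is_flat_cover [simp]: "is_flat (\<preceq>) (cover S)"
  by (simp add: is_flat_def)

lemma cover_flat: "is_flat (\<preceq>) C \<Longrightarrow> cover C = C"
  by (simp add: is_flat_def)

lemma cover_subset_flat_iff: "is_flat (\<preceq>) C \<Longrightarrow> cover S \<subseteq> C \<longleftrightarrow> S \<subseteq> C"
  using cover_subset_iff[of S C] by (simp add: is_flat_def)

section \<open>Ideals and primes\<close>

text \<open>The cancellation condition of a k-ideal is \<open>cover I \<subseteq> I\<close> written
  out. A flat contains \<open>0\<close> by \<open>zero_in_cover\<close>, and the unit
  \<open>1\<close> gives \<open>I \<subseteq> I * UNIV\<close>, so absorption is an
  equality.\<close>

lemma algebraic_ideal_iff_k_ideal: "algebraic_ideal (\<preceq>) I \<longleftrightarrow> k_ideal (\<preceq>) I"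
proof -
  have "I \<subseteq> I * UNIV"
  proof
    fix x assume "x \<in> I"
    then show "x \<in> I * UNIV" using set_times_intro[of x I 1 UNIV] by simp
  qed
  then have "I * UNIV = I \<longleftrightarrow> UNIV * I \<subseteq> I"
    by (auto simp: mult.commute[of UNIV I])
  moreover have "is_flat (\<preceq>) I \<longleftrightarrow> cover I \<subseteq> I"
    using subset_cover[of I] by (auto simp: is_flat_def)
  moreover have "cover I \<subseteq> I \<longleftrightarrow> 0 \<in> I \<and>
    (\<forall>c M N. set_mset M \<subseteq> I \<longrightarrow> set_mset N \<subseteq> I \<longrightarrow> {#c#} + M \<approx> N \<longrightarrow> c \<in> I)"
    using zero_in_cover[of I] unfolding alg_coverage_def by blast
  ultimately show ?thesis
    unfolding algebraic_ideal_def k_ideal_def by blast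
qed

text \<open>Since \<open>UNIV\<close> is its own cover, absorption passes from \<open>S\<close> to
  \<open>cover S\<close> by \<open>cover_times_subset\<close>. This supplies the ideals generated by
  \<open>P\<close> and one further element.\<close>

lemma algebraic_ideal_cover:
  assumes "UNIV * S \<subseteq> S"
  shows "algebraic_ideal (\<preceq>) (cover S)"
proof -
  have "cover UNIV = UNIV"
    using subset_cover by blast
  then have "UNIV * cover S \<subseteq> cover S"
    using cover_times_subset[of UNIV S] cover_mono[OF assms] by simp
  then show ?thesis
    by (simp add: algebraic_ideal_def)
qed

text \<open>A covering relation has finitely many terms, so all of them lie in a single member of
  the chain, which is flat.\<close>

lemma algebraic_ideal_Union_chain:
  assumes "subset.chain {I. algebraic_ideal (\<preceq>) I} \<I>" "\<I> \<noteq> {}"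
  shows "algebraic_ideal (\<preceq>) (\<Union>\<I>)"
proof -
  have ideal: "is_flat (\<preceq>) I" "UNIV * I \<subseteq> I" if "I \<in> \<I>" for I
    using assms(1) that by (auto simp: subset.chain_def algebraic_ideal_def)
  have "cover (\<Union>\<I>) \<subseteq> \<Union>\<I>"
  proof
    fix a assume "a \<in> cover (\<Union>\<I>)"
    then obtain M N where MN: "set_mset M \<subseteq> \<Union>\<I>" "set_mset N \<subseteq> \<Union>\<I>" "{#a#} + M \<approx> N"
      unfolding alg_coverage_def by auto
    obtain I where "I \<in> \<I>" "set_mset (M + N) \<subseteq> I"
      using finite_subset_Union_chain[OF _ _ assms(2,1), of "set_mset (M + N)"] MN(1,2) by auto
    then have "a \<in> cover I" "I \<in> \<I>"
      using MN(3) unfolding alg_coverage_def by auto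
    then show "a \<in> \<Union>\<I>"
      using ideal by (auto simp: is_flat_def)
  qed
  then show ?thesis
    using ideal(2) subset_cover[of "\<Union>\<I>"]
    by (fastforce simp: algebraic_ideal_def is_flat_def elim!: set_times_elim intro: set_times_intro)
qed

text \<open>An ideal \<open>P\<close> maximal among those containing \<open>J\<close> and disjoint
  from \<open>S\<close> is prime: if \<open>x\<close> and \<open>y\<close> lie outside
  \<open>P\<close>, the ideals generated by \<open>P\<close> with \<open>x\<close> and by
  \<open>P\<close> with \<open>y\<close> both meet \<open>S\<close>, and
  \<open>x * y \<in> P\<close> would put a product of two elements of \<open>S\<close> into
  \<open>P\<close>.\<close>

lemma prime_separation:
  assumes J: "algebraic_ideal (\<preceq>) J" and one: "1 \<in> S"
    and mult: "\<And>s t. s \<in> S \<Longrightarrow> t \<in> S \<Longrightarrow> s * t \<in> S" and disj: "J \<inter> S = {}"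
  obtains P where "P \<in> prime_spectrum (\<preceq>)" "J \<subseteq> P" "P \<inter> S = {}"
proof -
  let ?A = "{I. algebraic_ideal (\<preceq>) I \<and> J \<subseteq> I \<and> I \<inter> S = {}}"
  have "\<exists>P\<in>?A. \<forall>X\<in>?A. P \<subseteq> X \<longrightarrow> X = P"
  proof (rule subset_Zorn_nonempty)
    fix \<I> assume \<I>: "\<I> \<noteq> {}" "subset.chain ?A \<I>"
    then have "subset.chain {I. algebraic_ideal (\<preceq>) I} \<I>"
      by (auto simp: subset.chain_def)
    then show "\<Union>\<I> \<in> ?A"
      using algebraic_ideal_Union_chain \<I> by (auto simp: subset.chain_def)
  qed (use J disj in auto)
  then obtain P where P: "algebraic_ideal (\<preceq>) P" "J \<subseteq> P" "P \<inter> S = {}"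
    and max: "\<And>I. algebraic_ideal (\<preceq>) I \<Longrightarrow> P \<subseteq> I \<Longrightarrow> I \<inter> S = {} \<Longrightarrow> I = P"
    by (smt (verit, best) mem_Collect_eq order_trans)
  have PU: "a * p \<in> P" "p * a \<in> P" if "p \<in> P" for a p
    using P(1) that set_times_intro[of a UNIV p P]
    by (auto simp: algebraic_ideal_def mult.commute[of p])
  \<comment> \<open>\<open>cover (P \<union> UNIV * {x})\<close> is the ideal generated by
    \<open>P\<close> and \<open>x\<close>; it properly contains \<open>P\<close>, so maximality
    excludes disjointness from \<open>S\<close>.\<close>
  have meets: "cover (P \<union> UNIV * {x}) \<inter> S \<noteq> {}" if "x \<notin> P" for x
  proof
    assume *: "cover (P \<union> UNIV * {x}) \<inter> S = {}"
    have "UNIV * (P \<union> UNIV * {x}) \<subseteq> P \<union> UNIV * {x}"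
    proof
      fix z assume "z \<in> UNIV * (P \<union> UNIV * {x})"
      then obtain a u where "u \<in> P \<union> UNIV * {x}" "z = a * u"
        by (rule set_times_elim)
      then show "z \<in> P \<union> UNIV * {x}"
        using PU by (auto elim!: set_times_elim
            intro: set_times_intro[of "a * b" UNIV x "{x}" for b, unfolded mult.assoc])
    qed
    then have "cover (P \<union> UNIV * {x}) = P"
      using max[OF algebraic_ideal_cover _ *] subset_cover by blast
    moreover have "x \<in> P \<union> UNIV * {x}"
      using set_times_intro[of 1 UNIV x "{x}"] by simp
    ultimately show False
      using that subset_cover by blast
  qed
  have "x \<in> P \<or> y \<in> P" if xy: "x * y \<in> P" for x y
  proof (rule ccontr)
    assume "\<not> (x \<in> P \<or> y \<in> P)"
    then obtain s t where s: "s \<in> cover (P \<union> UNIV * {x})" "s \<in> S"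
      and t: "t \<in> cover (P \<union> UNIV * {y})" "t \<in> S"
      using meets by blast
    \<comment> \<open>Checked on generators: a factor in \<open>P\<close> keeps the product in
      \<open>P\<close>, and all other products are multiples of \<open>x * y\<close>.\<close>
    have "(P \<union> UNIV * {x}) * (P \<union> UNIV * {y}) \<subseteq> P"
    proof
      fix z assume "z \<in> (P \<union> UNIV * {x}) * (P \<union> UNIV * {y})"
      then obtain u v where uv: "u \<in> P \<union> UNIV * {x}" "v \<in> P \<union> UNIV * {y}" "z = u * v"
        by (rule set_times_elim)
      show "z \<in> P"
      proof (cases "u \<in> P \<or> v \<in> P")
        case True
        then show ?thesis using PU uv(3) by auto
      next
        case False
        then obtain a b where "u = a * x" "v = b * y"
          using uv by (auto elim!: set_times_elim)
        then have "z = (a * b) * (x * y)"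
          using uv(3) by (simp add: ac_simps)
        then show ?thesis using PU xy by auto
      qed
    qed
    then have "cover ((P \<union> UNIV * {x}) * (P \<union> UNIV * {y})) \<subseteq> P"
      using P(1) by (simp add: algebraic_ideal_def cover_subset_flat_iff)
    then have "s * t \<in> P"
      using cover_times_subset set_times_intro[OF s(1) t(1)] by blast
    then show False
      using P(3) mult[OF s(2) t(2)] by blast
  qed
  moreover have "P \<noteq> UNIV"
    using P(3) one by auto
  ultimately have "P \<in> prime_spectrum (\<preceq>)"
    using P(1) algebraic_ideal_iff_k_ideal by (simp add: prime_spectrum_def)
  then show thesis using that P by blast
qed

section \<open>The quantale of flats\<close>

lemma flat_quantale_simps [simp]:
  "carrier (flat_quantale (\<preceq>)) = {C. is_flat (\<preceq>) C}" "eq (flat_quantale (\<preceq>)) = (=)"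
  "le (flat_quantale (\<preceq>)) = (\<subseteq>)"
  "qmult (flat_quantale (\<preceq>)) = (\<lambda>C D. cover (C * D))"
  by (simp_all add: flat_quantale_def)

lemma least_Upper_flat_quantale:
  assumes "\<C> \<subseteq> {C. is_flat (\<preceq>) C}"
  shows "least (flat_quantale (\<preceq>)) (cover (\<Union>\<C>)) (Upper (flat_quantale (\<preceq>)) \<C>)"
  by (rule least_Upper_inclusionI) (use assms subset_cover in \<open>auto simp: cover_subset_flat_iff\<close>)

lemma Sup_flat_quantale:
  assumes "\<C> \<subseteq> {C. is_flat (\<preceq>) C}"
  shows "\<Squnion>\<^bsub>flat_quantale (\<preceq>)\<^esub>\<C> = cover (\<Union>\<C>)"
  by (intro partial_order.sup_eqI inclusion_partial_order least_Upper_flat_quantale)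
    (use assms in simp_all)

text \<open>Lets joins of flats be computed on generating sets.\<close>

lemma cover_Union_cover: "cover (\<Union>i\<in>I. cover (X i)) = cover (\<Union>i\<in>I. X i)"
proof (rule subset_antisym)
  have "cover (X i) \<subseteq> cover (\<Union>i\<in>I. X i)" if "i \<in> I" for i
    by (rule cover_mono) (use that in auto)
  then show "cover (\<Union>i\<in>I. cover (X i)) \<subseteq> cover (\<Union>i\<in>I. X i)"
    by (subst cover_subset_iff) blast
  show "cover (\<Union>i\<in>I. X i) \<subseteq> cover (\<Union>i\<in>I. cover (X i))"
    by (rule cover_mono) (use subset_cover in blast)
qed

lemma cover_times_cover_flat:
  assumes "is_flat (\<preceq>) C"
  shows "cover (C * cover T) = cover (C * T)"
  using cover_times_cover[of C T] by (simp add: cover_flat[OF assms])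

text \<open>The inner covers in joins and products are absorbed by the outer one, which leaves
  associativity and distributivity of the elementwise product of sets. Commutativity turns one
  distributive law into the other.\<close>

lemma quantale_flat_quantale: "quantale (flat_quantale (\<preceq>))"
proof -
  interpret partial_order "flat_quantale (\<preceq>)"
    by (rule inclusion_partial_order) simp_all
  have distrib: "cover (C * \<Squnion>\<^bsub>flat_quantale (\<preceq>)\<^esub>\<D>) =
      \<Squnion>\<^bsub>flat_quantale (\<preceq>)\<^esub>((\<lambda>D. cover (C * D)) ` \<D>)"
    if "is_flat (\<preceq>) C" "\<D> \<subseteq> {C. is_flat (\<preceq>) C}" for C \<D>
  proof -
    have "(\<Union>D\<in>\<D>. C * D) = C * \<Union>\<D>"
      by (auto elim!: set_times_elim intro: set_times_intro)
    moreover have "(\<lambda>D. cover (C * D)) ` \<D> \<subseteq> {C. is_flat (\<preceq>) C}"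
      by auto
    ultimately show ?thesis
      using that by (simp add: Sup_flat_quantale cover_Union_cover cover_times_cover_flat)
  qed
  show ?thesis
  proof unfold_locales
    fix \<C> assume "\<C> \<subseteq> carrier (flat_quantale (\<preceq>))"
    then show "\<exists>s. least (flat_quantale (\<preceq>)) s (Upper (flat_quantale (\<preceq>)) \<C>)"
      using least_Upper_flat_quantale by auto
  next
    fix C D E assume *: "C \<in> carrier (flat_quantale (\<preceq>))" "D \<in> carrier (flat_quantale (\<preceq>))"
      "E \<in> carrier (flat_quantale (\<preceq>))"
    \<comment> \<open>\<open>E\<close> is moved to the left so that the inner cover is a right
      factor on both sides; each then equals the cover of the triple product.\<close>
    then have "cover (E * cover (C * D)) = cover (C * cover (D * E))"
      by (simp add: cover_times_cover_flat ac_simps)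
    then show "C \<cdot>\<^bsub>flat_quantale (\<preceq>)\<^esub> D \<cdot>\<^bsub>flat_quantale (\<preceq>)\<^esub> E =
        C \<cdot>\<^bsub>flat_quantale (\<preceq>)\<^esub> (D \<cdot>\<^bsub>flat_quantale (\<preceq>)\<^esub> E)"
      by (simp add: mult.commute[of _ E])
  next
    fix C \<D> assume "C \<in> carrier (flat_quantale (\<preceq>))" "\<D> \<subseteq> carrier (flat_quantale (\<preceq>))"
    then show "(\<Squnion>\<^bsub>flat_quantale (\<preceq>)\<^esub>\<D>) \<cdot>\<^bsub>flat_quantale (\<preceq>)\<^esub> C =
        \<Squnion>\<^bsub>flat_quantale (\<preceq>)\<^esub>((\<lambda>D. D \<cdot>\<^bsub>flat_quantale (\<preceq>)\<^esub> C) ` \<D>)"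
      using distrib[of C \<D>] by (simp add: mult.commute[of _ C])
  qed (simp_all add: distrib)
qed

section \<open>The morphism to the open sets of the prime spectrum\<close>

text \<open>The complement of the vanishing set of \<open>C\<close>. As a union of basic open sets
  it is visibly open and compatible with unions.\<close>

definition opens :: "'a set \<Rightarrow> 'a set set" where
  "opens C = (\<Union>a\<in>C. basic_open (\<preceq>) a)"

lemma in_opens_iff: "P \<in> opens C \<longleftrightarrow> P \<in> prime_spectrum (\<preceq>) \<and> \<not> C \<subseteq> P"
  by (auto simp: opens_def basic_open_def)

lemma prime_spectrumD:
  assumes "P \<in> prime_spectrum (\<preceq>)"
  shows "is_flat (\<preceq>) P" "p \<in> P \<Longrightarrow> a * p \<in> P" "x * y \<in> P \<Longrightarrow> x \<in> P \<or> y \<in> P"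
proof -
  have *: "algebraic_ideal (\<preceq>) P" "x * y \<in> P \<Longrightarrow> x \<in> P \<or> y \<in> P"
    using assms by (auto simp: prime_spectrum_def algebraic_ideal_iff_k_ideal)
  then show "is_flat (\<preceq>) P" "x * y \<in> P \<Longrightarrow> x \<in> P \<or> y \<in> P"
    by (auto simp: algebraic_ideal_def)
  show "p \<in> P \<Longrightarrow> a * p \<in> P"
    using * set_times_intro[of a UNIV p P] by (auto simp: algebraic_ideal_def)
qed

text \<open>Primes are flat, so they cannot distinguish \<open>S\<close> from
  \<open>cover S\<close>.\<close>

lemma opens_cover [simp]: "opens (cover S) = opens S"
proof -
  have "cover S \<subseteq> P \<longleftrightarrow> S \<subseteq> P" if "P \<in> prime_spectrum (\<preceq>)" for P
    using that by (intro cover_subset_flat_iff prime_spectrumD(1))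
  then show ?thesis
    by (intro Set.set_eqI) (simp only: in_opens_iff cong: conj_cong)
qed

lemma opens_Union: "opens (\<Union>\<C>) = \<Union>(opens ` \<C>)"
  by (simp add: opens_def UN_UN_flatten)

text \<open>A prime contains \<open>C * D\<close> exactly when it contains \<open>C\<close> or
  \<open>D\<close>: one direction is primality, the other absorption.\<close>

lemma opens_times: "opens (C * D) = opens C \<inter> opens D"
proof -
  have "C * D \<subseteq> P \<longleftrightarrow> C \<subseteq> P \<or> D \<subseteq> P" if P: "P \<in> prime_spectrum (\<preceq>)" for P
  proof
    assume CD: "C * D \<subseteq> P"
    show "C \<subseteq> P \<or> D \<subseteq> P"
    proof (rule ccontr)
      assume "\<not> (C \<subseteq> P \<or> D \<subseteq> P)"
      then obtain c d where cd: "c \<in> C" "d \<in> D" "c \<notin> P" "d \<notin> P" by auto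
      then have "c * d \<in> P" using CD set_times_intro by blast
      then show False using prime_spectrumD(3)[OF P] cd by blast
    qed
  next
    assume "C \<subseteq> P \<or> D \<subseteq> P"
    moreover have "p * a \<in> P" if "p \<in> P" for p a
      using prime_spectrumD(2)[OF P that, of a] by (simp add: mult.commute)
    ultimately show "C * D \<subseteq> P"
      using prime_spectrumD(2)[OF P] by (auto elim!: set_times_elim)
  qed
  then show ?thesis
    by (intro Set.set_eqI) (auto simp only: in_opens_iff Int_iff)
qed

text \<open>The sets \<open>opens S\<close> include the generators and are stable under unions and,
  through products, under binary intersections. Replacing \<open>S\<close> by \<open>cover S\<close>
  makes the witness flat.\<close>

lemma openin_prime_spectrum_iff:
  "openin (prime_spectrum_topology (\<preceq>)) U \<longleftrightarrow> (\<exists>C. is_flat (\<preceq>) C \<and> opens C = U)"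
proof
  assume "openin (prime_spectrum_topology (\<preceq>)) U"
  then have "generate_topology_on (range (basic_open (\<preceq>))) U"
    by (simp add: prime_spectrum_topology_def openin_topology_generated_by_iff)
  then have "\<exists>S. opens S = U"
  proof induction
    case Empty
    show ?case by (auto simp: opens_def intro: exI[of _ "{}"])
  next
    case (Int U V)
    then show ?case using opens_times by metis
  next
    case (UN \<U>)
    then obtain S where "\<And>U. U \<in> \<U> \<Longrightarrow> opens (S U) = U" by metis
    then have "opens (\<Union>(S ` \<U>)) = \<Union>\<U>"
      by (simp add: opens_Union image_image)
    then show ?case ..
  next
    case (Basis U)
    then obtain a where "opens {a} = U" by (auto simp: opens_def)
    then show ?case ..
  qed
  then show "\<exists>C. is_flat (\<preceq>) C \<and> opens C = U"
    using opens_cover is_flat_cover by metis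
next
  assume "\<exists>C. is_flat (\<preceq>) C \<and> opens C = U"
  then show "openin (prime_spectrum_topology (\<preceq>)) U"
    unfolding opens_def prime_spectrum_topology_def
    by (blast intro: openin_Union topology_generated_by_Basis)
qed

lemma opens_image_carrier:
  "opens ` carrier (flat_quantale (\<preceq>)) = carrier (open_frame (prime_spectrum_topology (\<preceq>)))"
  by (auto simp: openin_prime_spectrum_iff)

lemma strong_morphism_opens:
  "strong_morphism (flat_quantale (\<preceq>)) (open_frame (prime_spectrum_topology (\<preceq>))) opens"
proof -
  have "opens ` \<C> \<subseteq> {U. openin (prime_spectrum_topology (\<preceq>)) U}"
    if "\<C> \<subseteq> {C. is_flat (\<preceq>) C}" for \<C>
    using that opens_image_carrier by auto
  then show ?thesis
    using opens_image_carrier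
    by (auto simp: strong_morphism_def Sup_flat_quantale Sup_open_frame opens_Union opens_times)
qed

text \<open>The elements \<open>a\<close> with \<open>\<phi> [a] \<le> \<phi> D\<close> form an ideal, radical because multiplication in a frame
  is idempotent; so every \<open>c\<close> outside it is separated from \<open>D\<close> by a prime.\<close>

lemma strong_morphism_le_if_opens_subset:
  assumes F: "frame F" and \<phi>: "strong_morphism (flat_quantale (\<preceq>)) F \<phi>"
    and CD: "is_flat (\<preceq>) C" "is_flat (\<preceq>) D" and sub: "opens C \<subseteq> opens D"
  shows "\<phi> C \<sqsubseteq>\<^bsub>F\<^esub> \<phi> D"
proof -
  interpret F: frame F by fact
  have carr [simp]: "\<phi> X \<in> carrier F" if "is_flat (\<preceq>) X" for X
    using \<phi> that by (auto simp: strong_morphism_def)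
  have mono: "\<phi> X \<sqsubseteq>\<^bsub>F\<^esub> \<phi> Y" if "X \<subseteq> Y" "is_flat (\<preceq>) X" "is_flat (\<preceq>) Y" for X Y
    using strong_morphism_mono[OF quantale_flat_quantale F.suplattice_axioms \<phi>] that by simp
  \<comment> \<open>\<open>cover S\<close> is the join of the flats \<open>cover {s}\<close>, and
    \<open>\<phi>\<close> preserves this join.\<close>
  have cover_le: "\<phi> (cover S) \<sqsubseteq>\<^bsub>F\<^esub> \<phi> D" if S: "\<And>s. s \<in> S \<Longrightarrow> \<phi> (cover {s}) \<sqsubseteq>\<^bsub>F\<^esub> \<phi> D" for S
  proof -
    have sub: "(\<lambda>s. cover {s}) ` S \<subseteq> {C. is_flat (\<preceq>) C}" by auto
    have "cover S = \<Squnion>\<^bsub>flat_quantale (\<preceq>)\<^esub>((\<lambda>s. cover {s}) ` S)"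
      using sub by (simp add: Sup_flat_quantale cover_Union_cover)
    then have "\<phi> (cover S) = \<Squnion>\<^bsub>F\<^esub>((\<lambda>s. \<phi> (cover {s})) ` S)"
      using \<phi> sub by (simp add: strong_morphism_def image_image)
    also have "\<dots> \<sqsubseteq>\<^bsub>F\<^esub> \<phi> D"
      by (rule F.sup_least) (use S CD in auto)
    finally show ?thesis .
  qed
  have mult: "\<phi> (cover {a * b}) = \<phi> (cover {a}) \<sqinter>\<^bsub>F\<^esub> \<phi> (cover {b})" for a b
  proof -
    have "{a} * {b} = {a * b}"
      by (auto simp: set_times_def)
    then have "\<phi> (cover {a * b}) = \<phi> (cover (cover {a} * cover {b}))"
      by (simp add: cover_times_cover)
    also have "\<dots> = \<phi> (cover {a}) \<cdot>\<^bsub>F\<^esub> \<phi> (cover {b})"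
      using \<phi> by (simp add: strong_morphism_def)
    finally show ?thesis by (simp add: F.qmult_meet)
  qed
  define J where "J = {a. \<phi> (cover {a}) \<sqsubseteq>\<^bsub>F\<^esub> \<phi> D}"
  have J_mult: "a * b \<in> J" if "b \<in> J" for a b
  proof -
    have "\<phi> (cover {a * b}) \<sqsubseteq>\<^bsub>F\<^esub> \<phi> (cover {b})"
      by (simp add: mult F.meet_right)
    then show ?thesis
      using that CD F.le_trans[of "\<phi> (cover {a * b})" "\<phi> (cover {b})" "\<phi> D"] by (simp add: J_def)
  qed
  have "cover J \<subseteq> J"
  proof
    fix a assume "a \<in> cover J"
    then have "\<phi> (cover {a}) \<sqsubseteq>\<^bsub>F\<^esub> \<phi> (cover J)"
      by (intro mono) (simp_all add: cover_subset_iff)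
    moreover have "\<phi> (cover J) \<sqsubseteq>\<^bsub>F\<^esub> \<phi> D"
      by (rule cover_le) (simp add: J_def)
    ultimately show "a \<in> J"
      using CD F.le_trans[of "\<phi> (cover {a})" "\<phi> (cover J)" "\<phi> D"] by (simp add: J_def)
  qed
  then have J: "algebraic_ideal (\<preceq>) J"
    using J_mult subset_cover[of J] by (auto simp: algebraic_ideal_def is_flat_def elim!: set_times_elim)
  have "D \<subseteq> J"
    using mono CD by (auto simp: J_def cover_subset_flat_iff)
  have idem: "x \<sqinter>\<^bsub>F\<^esub> x = x" if "x \<in> carrier F" for x
    using that by (intro F.le_antisym F.meet_le F.meet_left) simp_all
  \<comment> \<open>The exponents start at \<open>1\<close>, since \<open>\<phi> (cover {1})\<close>
    may differ from \<open>\<phi> (cover {c})\<close>.\<close>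
  have power: "\<phi> (cover {c ^ Suc n}) = \<phi> (cover {c})" for c n
    by (induction n) (simp_all add: mult[of c] idem del: power_Suc add: power_Suc[of c "Suc _"])
  have "C \<subseteq> J"
  proof
    fix c assume "c \<in> C"
    show "c \<in> J"
    proof (rule ccontr)
      assume "c \<notin> J"
      \<comment> \<open>The exponent \<open>0\<close> is treated apart: \<open>1 \<in> J\<close>
        would give \<open>c * 1 \<in> J\<close>. The powers of \<open>c\<close> thus form a
        multiplicative set disjoint from \<open>J\<close>.\<close>
      have pow: "c ^ n \<notin> J" for n
        using \<open>c \<notin> J\<close> power[of c] J_mult[of 1 c] by (cases n) (auto simp: J_def)
      obtain P where P: "P \<in> prime_spectrum (\<preceq>)" "J \<subseteq> P" "P \<inter> range ((^) c) = {}"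
      proof (rule prime_separation[OF J])
        show "1 \<in> range ((^) c)"
          by (rule range_eqI[of _ _ 0]) simp
        show "s * t \<in> range ((^) c)" if "s \<in> range ((^) c)" "t \<in> range ((^) c)" for s t
          using that by (auto simp: power_add[symmetric])
      qed (use pow in auto)
      have "c \<notin> P"
        using P(3) range_eqI[of c "(^) c" 1] by auto
      then have "P \<in> opens C"
        using P(1) \<open>c \<in> C\<close> by (auto simp: in_opens_iff)
      then have "P \<in> opens D"
        using sub by blast
      then show False
        using P(2) \<open>D \<subseteq> J\<close> by (auto simp: in_opens_iff)
    qed
  qed
  then have "\<phi> (cover {c}) \<sqsubseteq>\<^bsub>F\<^esub> \<phi> D" if "c \<in> C" for c
    using that by (auto simp: J_def)
  then have "\<phi> (cover C) \<sqsubseteq>\<^bsub>F\<^esub> \<phi> D"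
    by (rule cover_le)
  then show ?thesis
    using CD by (simp add: cover_flat)
qed

text \<open>Flats with equal images under \<open>opens\<close> satisfy both inclusions, so
  antisymmetry in \<open>F\<close> gives the kernel condition of
  \<open>strong_morphism_factor\<close>.\<close>

lemma is_Spec_opens:
  "is_Spec TYPE('f) (flat_quantale (\<preceq>)) (open_frame (prime_spectrum_topology (\<preceq>))) opens"
  unfolding is_Spec_def
proof (intro conjI allI impI)
  fix F :: "'f mult_order" and \<phi>
  assume F: "frame F" and \<phi>: "strong_morphism (flat_quantale (\<preceq>)) F \<phi>"
  interpret F: frame F by fact
  show "\<exists>!g. g \<in> extensional (carrier (open_frame (prime_spectrum_topology (\<preceq>)))) \<and>
      strong_morphism (open_frame (prime_spectrum_topology (\<preceq>))) F g \<and>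
      (\<forall>x\<in>carrier (flat_quantale (\<preceq>)). g (opens x) = \<phi> x)"
  proof (rule strong_morphism_factor[OF quantale_flat_quantale strong_morphism_opens
        opens_image_carrier \<phi>])
    fix C D assume "C \<in> carrier (flat_quantale (\<preceq>))" "D \<in> carrier (flat_quantale (\<preceq>))"
      "opens C = opens D"
    then show "\<phi> C = \<phi> D"
      using \<phi> by (intro F.le_antisym strong_morphism_le_if_opens_subset[OF F \<phi>])
        (auto simp: strong_morphism_def)
  qed
qed (rule quantale_flat_quantale frame_open_frame strong_morphism_opens)+

end

theorem proposition4p6:
  fixes leq :: "'a::{comm_monoid_mult, mult_zero} multiset \<Rightarrow> 'a multiset \<Rightarrow> bool"
  assumes "ordered_blueprint leq"
  shows "{I. algebraic_ideal leq I} = {I. k_ideal leq I} \<and>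
    is_Spec TYPE('f) (flat_quantale leq) (open_frame (prime_spectrum_topology leq))
      (\<lambda>C. \<Union>a\<in>C. basic_open leq a)"
proof -
  interpret ordered_blueprint leq by fact
  have "(\<lambda>C. \<Union>a\<in>C. basic_open leq a) = opens"
    by (simp add: opens_def fun_eq_iff)
  then show ?thesis
    using algebraic_ideal_iff_k_ideal is_Spec_opens by simp
qed

end
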